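(* Let $S$ be a non-singular step set with positive weights. For $p\ge1$ let ${\sf A}_p(\frac1y;t)$, ${\sf B}_p(\frac1x;t)$, ${\sf F}_p(t)$ be the series defined in the context for walks starting at $(p,0)$, and set ${\sf W}_A(\frac1y;t)={\sf A}_1(\frac1y;t)$ and ${\sf W}_B(\frac1x;t)=x-{\sf F}_1(t)-{\sf B}_1(\frac1x;t)$. Then for each $p\ge1$ there is a polynomial $H_p$ of degree $p$, with coefficients formal power series in $t$, satisfying \[{\sf A}_p\left(\tfrac1y;t\right)=H_p\left({\sf W}_A\left(\tfrac1y;t\right)\right)-H_p(0),\qquad {\sf F}_p(t)=H_p(0),\qquad {\sf B}_p\left(\tfrac1x;t\right)=x^p-H_p\left({\sf W}_B\left(\tfrac1x;t\right)\right).\] Moreover $H_p$ is uniquely determined by the fact that $x^p-H_p({\sf W}_B(\frac1x;t))$ lies in $\frac1x\mathbb{R}[\frac1x][[t]]$.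
   Context: $S\subset\{-1,0,1\}^2\setminus\{(0,0)\}$ is non-singular if for every line through the origin each open half-plane it bounds contains an element of $S$; each $s\in S$ has weight $w_s>0$. Let $\mathcal{C}=\{(i,j)\in\mathbb{Z}^2:i>0\text{ or }j>0\}$. For a starting point $(p,0)$ with $p\ge1$, consider weighted walks (weight = product of step weights, times $t^{\text{length}}$) of length $\ge1$ starting at $(p,0)$ using steps in $S$ such that all points except the last lie in $\mathcal{C}$ and the last point lies outside $\mathcal{C}$. ${\sf A}_p(\frac1y;t)$ is the generating function of those ending at $(0,j)$ with $j<0$, marked by $y^j$; ${\sf B}_p(\frac1x;t)$ of those ending at $(i,0)$ with $i<0$, marked by $x^i$; ${\sf F}_p(t)$ of those ending at $(0,0)$. Thus ${\sf A}_p\in\frac ty\mathbb{R}[\frac1y][[t]]$, ${\sf B}_p\in\frac tx\mathbb{R}[\frac1x][[t]]$, ${\sf F}_p\in t\mathbb{R}[[t]]$. *)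

theory Defs
  imports
    "HOL-Computational_Algebra.Computational_Algebra"
    "HOL-Library.Poly_Mapping"
    "HOL-Library.Product_Plus"
begin

type_synonym point = "int \<times> int"

definition small_steps :: "point set"
  where "small_steps = {-1, 0, 1} \<times> {-1, 0, 1} - {(0, 0)}"

text \<open>The line through the origin with normal vector \<open>(a, b)\<close> bounds the open half-planes
  \<open>a x + b y > 0\<close> and \<open>a x + b y < 0\<close>.\<close>

definition non_singular :: "point set \<Rightarrow> bool"
  where "non_singular S \<longleftrightarrow>
    (\<forall>a b :: real. (a, b) \<noteq> (0, 0) \<longrightarrow>
      (\<exists>(i, j) \<in> S. a * of_int i + b * of_int j > 0) \<and>
      (\<exists>(i, j) \<in> S. a * of_int i + b * of_int j < 0))"

definition cone :: "point set"
  where "cone = {(i, j). i > 0 \<or> j > 0}"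

text \<open>A walk is given by its list of steps; it visits the points
  \<open>u + sum_list (take k s)\<close> for \<open>k \<le> length s\<close>.\<close>

definition exit_walks :: "point set \<Rightarrow> point \<Rightarrow> nat \<Rightarrow> point list set"
  where "exit_walks S u n = {s. length s = n \<and> n \<ge> 1 \<and> set s \<subseteq> S \<and>
    (\<forall>k<n. u + sum_list (take k s) \<in> cone) \<and> u + sum_list s \<notin> cone}"

definition walk_weight :: "(point \<Rightarrow> real) \<Rightarrow> point list \<Rightarrow> real"
  where "walk_weight w s = prod_list (map w s)"

text \<open>Laurent polynomials in one variable are finitely supported functions from exponents in
  \<open>int\<close> to coefficients, with convolution as product: \<open>Poly_Mapping.single k c\<close> is the
  monomial \<open>c x\<^sup>k\<close>, where \<open>k\<close> may be negative. The same type serves for the variables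
  \<open>x\<close> and \<open>y\<close>, which never occur together. Series in \<open>t\<close> are formal power series over
  this ring.\<close>

type_synonym laurent_series_t = "(int \<Rightarrow>\<^sub>0 real) fps"

text \<open>The sums below range over finite sets when \<open>S\<close> is finite.\<close>

definition gf_A :: "point set \<Rightarrow> (point \<Rightarrow> real) \<Rightarrow> nat \<Rightarrow> laurent_series_t"
  where "gf_A S w p = Abs_fps (\<lambda>n.
    \<Sum>s \<in> {s \<in> exit_walks S (int p, 0) n. \<exists>j<0. (int p, 0) + sum_list s = (0, j)}.
      Poly_Mapping.single (snd ((int p, 0) + sum_list s)) (walk_weight w s))"

definition gf_B :: "point set \<Rightarrow> (point \<Rightarrow> real) \<Rightarrow> nat \<Rightarrow> laurent_series_t"
  where "gf_B S w p = Abs_fps (\<lambda>n.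
    \<Sum>s \<in> {s \<in> exit_walks S (int p, 0) n. \<exists>i<0. (int p, 0) + sum_list s = (i, 0)}.
      Poly_Mapping.single (fst ((int p, 0) + sum_list s)) (walk_weight w s))"

definition gf_F :: "point set \<Rightarrow> (point \<Rightarrow> real) \<Rightarrow> nat \<Rightarrow> real fps"
  where "gf_F S w p = Abs_fps (\<lambda>n.
    \<Sum>s \<in> {s \<in> exit_walks S (int p, 0) n. (int p, 0) + sum_list s = (0, 0)}. walk_weight w s)"

text \<open>The canonical embedding of \<open>\<real>[[t]]\<close> into \<open>\<real>[x, 1/x][[t]]\<close>.\<close>

definition emb :: "real fps \<Rightarrow> laurent_series_t"
  where "emb f = Abs_fps (\<lambda>n. Poly_Mapping.single 0 (fps_nth f n))"

definition var_x :: laurent_series_t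
  where "var_x = fps_const (Poly_Mapping.single 1 1)"

definition eval_H :: "real fps poly \<Rightarrow> laurent_series_t \<Rightarrow> laurent_series_t"
  where "eval_H H f = poly (map_poly emb H) f"

definition W_A :: "point set \<Rightarrow> (point \<Rightarrow> real) \<Rightarrow> laurent_series_t"
  where "W_A S w = gf_A S w 1"

definition W_B :: "point set \<Rightarrow> (point \<Rightarrow> real) \<Rightarrow> laurent_series_t"
  where "W_B S w = var_x - emb (gf_F S w 1) - gf_B S w 1"

text \<open>The set \<open>1/x \<real>[1/x][[t]]\<close>: every coefficient of \<open>t\<^sup>n\<close> has only negative exponents.\<close>

definition negative_part :: "laurent_series_t set"
  where "negative_part = {f. \<forall>n. Poly_Mapping.keys (fps_nth f n) \<subseteq> {..<0}}"

end

theory Submission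
  imports Defs
begin

text \<open>Write \<open>K = 1 - t S(x, y)\<close>. Call \<open>(\<alpha>(x), \<beta>(y))\<close> an invariant pair if
  \<open>\<alpha>(x) - \<beta>(y) = K D\<close> for some \<open>D\<close> supported in the cone \<open>\<C>\<close>. Counting walks that stay in \<open>\<C>\<close>
  by their last step shows that \<open>(x\<^sup>p - F\<^sub>p - B\<^sub>p, A\<^sub>p)\<close> is an invariant pair; for \<open>p = 1\<close> it is
  \<open>(W\<^sub>B, W\<^sub>A)\<close>. The crux is that invariant pairs are closed under products, which is a
  conservation law for the flow of the convolution of two such \<open>D\<close>'s. Hence \<open>(H(W\<^sub>B), H(W\<^sub>A))\<close>
  is invariant for every polynomial \<open>H\<close>. Since \<open>W\<^sub>B\<close> is \<open>x\<close> plus nonpositive powers of \<open>x\<close>, there is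
  exactly one \<open>H\<close> for which \<open>x\<^sup>p - H(W\<^sub>B)\<close> has only negative powers. The difference of the two
  pairs then has no part in \<open>\<C>\<close>, so it vanishes because \<open>K = 1 + O(t)\<close>.\<close>

section \<open>Supports of series over a monoid ring\<close>

text \<open>One bound for the coefficients of all powers of \<open>t\<close>. Degree estimates,
  positions in the plane and vanishing are all expressed this way: products add supports, and
  incompatible bounds force a series to be zero.\<close>

definition supported_in :: "'a set \<Rightarrow> ('a \<Rightarrow>\<^sub>0 'b::zero) fps \<Rightarrow> bool"
  where "supported_in A f \<longleftrightarrow> (\<forall>n. Poly_Mapping.keys (fps_nth f n) \<subseteq> A)"

lemma supported_in_mono: "supported_in A f \<Longrightarrow> A \<subseteq> B \<Longrightarrow> supported_in B f"
  by (auto simp: supported_in_def)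

lemma supported_in_zero [simp]: "supported_in A 0"
  by (simp add: supported_in_def)

lemma supported_in_add:
  fixes f g :: "('a \<Rightarrow>\<^sub>0 'b::monoid_add) fps"
  shows "supported_in A f \<Longrightarrow> supported_in A g \<Longrightarrow> supported_in A (f + g)"
  unfolding supported_in_def using keys_add by fastforce

lemma supported_in_uminus:
  fixes f :: "('a \<Rightarrow>\<^sub>0 'b::ab_group_add) fps"
  shows "supported_in A f \<Longrightarrow> supported_in A (- f)"
  by (simp add: supported_in_def)

lemma supported_in_diff:
  fixes f g :: "('a \<Rightarrow>\<^sub>0 'b::ab_group_add) fps"
  shows "supported_in A f \<Longrightarrow> supported_in A g \<Longrightarrow> supported_in A (f - g)"
  using supported_in_add[of A f "- g"] supported_in_uminus[of A g] by simp

lemma supported_in_sum: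
  fixes f :: "'i \<Rightarrow> ('a \<Rightarrow>\<^sub>0 'b::comm_monoid_add) fps"
  shows "(\<And>i. i \<in> I \<Longrightarrow> supported_in A (f i)) \<Longrightarrow> supported_in A (sum f I)"
  by (induction I rule: infinite_finite_induct) (auto intro: supported_in_add)

lemma keys_sum_subset:
  fixes f :: "'i \<Rightarrow> ('a \<Rightarrow>\<^sub>0 'b::comm_monoid_add)"
  shows "(\<And>i. i \<in> I \<Longrightarrow> Poly_Mapping.keys (f i) \<subseteq> A) \<Longrightarrow> Poly_Mapping.keys (sum f I) \<subseteq> A"
proof (induction I rule: infinite_finite_induct)
  case (insert i I)
  then show ?case using keys_add[of "f i" "sum f I"] by fastforce
qed auto

lemma supported_in_mult:
  fixes f g :: "('a::monoid_add \<Rightarrow>\<^sub>0 'b::semiring_0) fps"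
  assumes "supported_in A f" "supported_in B g"
    and "\<And>a b. a \<in> A \<Longrightarrow> b \<in> B \<Longrightarrow> a + b \<in> C"
  shows "supported_in C (f * g)"
  unfolding supported_in_def
proof
  fix n
  have "Poly_Mapping.keys (fps_nth f i * fps_nth g (n - i)) \<subseteq> C" for i
    using keys_mult[of "fps_nth f i" "fps_nth g (n - i)"] assms
    unfolding supported_in_def by blast
  then show "Poly_Mapping.keys (fps_nth (f * g) n) \<subseteq> C"
    unfolding fps_mult_nth by (intro keys_sum_subset)
qed

lemma supported_in_fps_const: "supported_in A (fps_const c) \<longleftrightarrow> Poly_Mapping.keys c \<subseteq> A"
  by (auto simp: supported_in_def)

lemma supported_in_one: "supported_in {0} (1 :: ('a::monoid_add \<Rightarrow>\<^sub>0 'b::semiring_1) fps)"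
  by (simp add: supported_in_def)

lemma supported_in_empty: "supported_in {} f \<Longrightarrow> f = 0"
  by (simp add: supported_in_def fps_eq_iff)

lemma supported_in_disjoint:
  assumes "supported_in A f" "supported_in B f" "A \<inter> B = {}"
  shows "f = 0"
proof (rule supported_in_empty)
  show "supported_in {} f" using assms unfolding supported_in_def by blast
qed

lemma supported_in_iff_lookup:
  "supported_in A f \<longleftrightarrow> (\<forall>n P. P \<notin> A \<longrightarrow> Poly_Mapping.lookup (fps_nth f n) P = 0)"
  unfolding supported_in_def subset_iff in_keys_iff by blast

section \<open>Cutting a series down to a set of exponents\<close>

definition restrict_supp :: "'a set \<Rightarrow> ('a \<Rightarrow>\<^sub>0 'b::zero) fps \<Rightarrow> ('a \<Rightarrow>\<^sub>0 'b) fps"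
  where "restrict_supp A f =
    Abs_fps (\<lambda>n. Poly_Mapping.mapp (\<lambda>k v. v when k \<in> A) (fps_nth f n))"

lemma lookup_restrict_supp:
  "Poly_Mapping.lookup (fps_nth (restrict_supp A f) n) k = (Poly_Mapping.lookup (fps_nth f n) k when k \<in> A)"
  by (simp add: restrict_supp_def lookup_mapp in_keys_iff when_def)

lemma supported_in_restrict:
  "supported_in B f \<Longrightarrow> supported_in (A \<inter> B) (restrict_supp A f)"
  by (auto simp: supported_in_iff_lookup lookup_restrict_supp)

lemma supported_in_diff_restrict:
  fixes f :: "('a \<Rightarrow>\<^sub>0 'b::ab_group_add) fps"
  shows "supported_in B f \<Longrightarrow> supported_in (B - A) (f - restrict_supp A f)"
  by (auto simp: supported_in_iff_lookup lookup_restrict_supp lookup_minus)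

section \<open>Substitution of monomials\<close>

text \<open>Pushforward of exponents: the monomials are summed, so coefficients add up when
  \<open>h\<close> identifies exponents. For additive \<open>h\<close> this is a homomorphism of
  monoid rings.\<close>

definition push :: "('a \<Rightarrow> 'c) \<Rightarrow> ('a \<Rightarrow>\<^sub>0 'b::comm_monoid_add) \<Rightarrow> ('c \<Rightarrow>\<^sub>0 'b)"
  where "push h p = (\<Sum>k\<in>Poly_Mapping.keys p. Poly_Mapping.single (h k) (Poly_Mapping.lookup p k))"

lemma push_superset:
  assumes "finite A" "Poly_Mapping.keys p \<subseteq> A"
  shows "push h p = (\<Sum>k\<in>A. Poly_Mapping.single (h k) (Poly_Mapping.lookup p k))"
  unfolding push_def using assms
  by (intro sum.mono_neutral_left) (auto simp: in_keys_iff)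

lemma push_zero [simp]: "push h 0 = 0"
  by (simp add: push_def)

lemma push_add: "push h (p + q) = push h p + push h q"
proof -
  let ?A = "Poly_Mapping.keys p \<union> Poly_Mapping.keys q"
  have "push h (p + q) = (\<Sum>k\<in>?A. Poly_Mapping.single (h k) (Poly_Mapping.lookup (p + q) k))"
    using keys_add[of p q] by (intro push_superset) auto
  also have "\<dots> = push h p + push h q"
    by (simp add: push_superset[of ?A] lookup_add single_add sum.distrib)
  finally show ?thesis .
qed

lemma push_sum: "push h (sum f I) = (\<Sum>i\<in>I. push h (f i))"
  by (induction I rule: infinite_finite_induct) (auto simp: push_add)

lemma push_single [simp]: "push h (Poly_Mapping.single k c) = Poly_Mapping.single (h k) c"
  by (simp add: push_def)

lemma sum_single_lookup:
  "(\<Sum>k\<in>Poly_Mapping.keys p. Poly_Mapping.single k (Poly_Mapping.lookup p k)) = p"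
  by (rule poly_mapping_eqI) (auto simp: lookup_sum lookup_single when_def in_keys_iff)

lemma single_sum: "Poly_Mapping.single k (sum f I) = (\<Sum>i\<in>I. Poly_Mapping.single k (f i))"
  by (induction I rule: infinite_finite_induct) (auto simp: single_add)

lemma push_mult:
  fixes p q :: "'a::monoid_add \<Rightarrow>\<^sub>0 'b::semiring_0"
  assumes "\<And>k l. h (k + l) = h k + h l"
  shows "push h (p * q) = push h p * (push h q :: 'c::monoid_add \<Rightarrow>\<^sub>0 'b)"
proof -
  have "push h (p * q) = push h
      ((\<Sum>k\<in>Poly_Mapping.keys p. Poly_Mapping.single k (Poly_Mapping.lookup p k)) *
       (\<Sum>k\<in>Poly_Mapping.keys q. Poly_Mapping.single k (Poly_Mapping.lookup q k)))"
    by (simp only: sum_single_lookup)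
  also have "\<dots> = push h p * push h q"
    by (simp add: sum_product push_sum mult_single assms push_def[of h p] push_def[of h q])
  finally show ?thesis .
qed

lemma lookup_push_inj:
  assumes "inj h"
  shows "Poly_Mapping.lookup (push h p) (h k) = Poly_Mapping.lookup p k"
  using assms by (auto simp: push_def lookup_sum lookup_single when_def inj_eq in_keys_iff)

definition subst :: "('a \<Rightarrow> 'c) \<Rightarrow> ('a \<Rightarrow>\<^sub>0 'b::comm_monoid_add) fps \<Rightarrow> ('c \<Rightarrow>\<^sub>0 'b) fps"
  where "subst h f = Abs_fps (\<lambda>n. push h (fps_nth f n))"

lemma subst_add: "subst h (f + g) = subst h f + subst h g"
  by (simp add: subst_def fps_eq_iff push_add)

lemma subst_diff:
  fixes f g :: "('a \<Rightarrow>\<^sub>0 'b::ab_group_add) fps"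
  shows "subst h (f - g) = subst h f - subst h g"
  using subst_add[of h "f - g" g] by (simp add: algebra_simps)

lemma subst_mult:
  fixes f g :: "('a::monoid_add \<Rightarrow>\<^sub>0 'b::semiring_0) fps"
  assumes "\<And>k l. h (k + l) = h k + h l"
  shows "subst h (f * g) = subst h f * (subst h g :: ('c::monoid_add \<Rightarrow>\<^sub>0 'b) fps)"
  by (simp add: subst_def fps_eq_iff fps_mult_nth push_sum push_mult[of h, OF assms])

lemma supported_in_subst:
  assumes "supported_in A f"
  shows "supported_in (h ` A) (subst h f)"
  unfolding supported_in_def
proof
  fix n
  show "Poly_Mapping.keys (fps_nth (subst h f) n) \<subseteq> h ` A"
    unfolding subst_def push_def fps_nth_Abs_fps
    using assms by (intro keys_sum_subset) (auto simp: supported_in_def)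
qed

lemma subst_eq_0_inj:
  assumes "inj h" "subst h f = 0"
  shows "f = 0"
proof (rule fps_ext, rule poly_mapping_eqI)
  fix n k
  have "push h (fps_nth f n) = 0" using assms(2) by (simp add: subst_def fps_eq_iff)
  then show "Poly_Mapping.lookup (fps_nth f n) k = Poly_Mapping.lookup (fps_nth 0 n) k"
    using lookup_push_inj[OF assms(1), of "fps_nth f n" k] by simp
qed

text \<open>One type serves for series in \<open>x\<close> and in \<open>y\<close>; placing them on
  the two axes of the plane lets them meet in a common bivariate ring.\<close>

definition in_x :: "laurent_series_t \<Rightarrow> (point \<Rightarrow>\<^sub>0 real) fps"
  where "in_x = subst (\<lambda>k. (k, 0))"

definition in_y :: "laurent_series_t \<Rightarrow> (point \<Rightarrow>\<^sub>0 real) fps"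
  where "in_y = subst (\<lambda>k. (0, k))"

lemma in_x_simps:
  "in_x (f + g) = in_x f + in_x g" "in_x (f - g) = in_x f - in_x g" "in_x (f * g) = in_x f * in_x g"
  by (simp_all add: in_x_def subst_add subst_diff subst_mult)

lemma in_y_simps:
  "in_y (f + g) = in_y f + in_y g" "in_y (f - g) = in_y f - in_y g" "in_y (f * g) = in_y f * in_y g"
  by (simp_all add: in_y_def subst_add subst_diff subst_mult)

lemma supported_in_in_x: "supported_in A f \<Longrightarrow> supported_in (A \<times> {0}) (in_x f)"
  unfolding in_x_def by (drule supported_in_subst) (auto elim: supported_in_mono)

lemma supported_in_in_y: "supported_in A f \<Longrightarrow> supported_in ({0} \<times> A) (in_y f)"
  unfolding in_y_def by (drule supported_in_subst) (auto elim: supported_in_mono)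

lemma supported_in_UNIV: "supported_in UNIV f"
  by (simp add: supported_in_def)

lemmas supported_in_x_axis = supported_in_in_x[OF supported_in_UNIV]
  and supported_in_y_axis = supported_in_in_y[OF supported_in_UNIV]

lemma in_x_eq_0: "in_x f = 0 \<Longrightarrow> f = 0"
  unfolding in_x_def by (erule subst_eq_0_inj[rotated]) (simp add: inj_def)

lemma in_y_eq_0: "in_y f = 0 \<Longrightarrow> f = 0"
  unfolding in_y_def by (erule subst_eq_0_inj[rotated]) (simp add: inj_def)

lemma in_x_emb: "in_x (emb c) = in_y (emb c)"
  by (simp add: in_x_def in_y_def emb_def subst_def)

section \<open>Polynomials in Laurent series\<close>

lemma emb_simps:
  "emb 0 = 0" "emb 1 = 1" "emb (c + d) = emb c + emb d" "emb (c - d) = emb c - emb d"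
  "emb (c * d) = emb c * emb d"
proof -
  show "emb (c * d) = emb c * emb d"
    by (simp add: emb_def fps_eq_iff fps_mult_nth single_sum mult_single)
qed (auto simp: emb_def fps_eq_iff single_add single_diff)

lemma emb_eq_0: "emb c = 0 \<Longrightarrow> c = 0"
  by (simp add: emb_def fps_eq_iff poly_mapping_eq_iff fun_eq_iff lookup_single when_def)
    (metis)

lemma supported_in_emb: "supported_in {0} (emb c)"
  by (simp add: emb_def supported_in_def)

lemma eval_H_0 [simp]: "eval_H 0 f = 0"
  by (simp add: eval_H_def)

lemma eval_H_pCons: "eval_H (pCons c H) f = emb c + f * eval_H H f"
  by (simp add: eval_H_def map_poly_pCons emb_simps)

lemma eval_H_add: "eval_H (G + H) f = eval_H G f + eval_H H f"
proof (induction G arbitrary: H)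
  case (pCons c G)
  obtain d H' where H: "H = pCons d H'" by (cases H)
  show ?case by (simp add: H eval_H_pCons pCons.IH emb_simps algebra_simps)
qed auto

lemma eval_H_diff: "eval_H (G - H) f = eval_H G f - eval_H H f"
  using eval_H_add[of "G - H" H f] by (simp add: algebra_simps)

lemma eval_H_monom: "eval_H (monom c k) f = emb c * f ^ k"
  by (simp add: eval_H_def map_poly_monom emb_simps poly_monom)

lemma eval_H_altdef: "eval_H H f = (\<Sum>i\<le>degree H. emb (coeff H i) * f ^ i)"
proof -
  have "eval_H H f = eval_H (\<Sum>i\<le>degree H. monom (coeff H i) i) f"
    by (simp add: poly_as_sum_of_monoms)
  also have "\<dots> = (\<Sum>i\<le>degree H. eval_H (monom (coeff H i) i) f)"
    using sum_comp_morphism[of "\<lambda>G. eval_H G f" "\<lambda>i. monom (coeff H i) i" "{..degree H}"]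
    by (simp add: eval_H_add o_def)
  finally show ?thesis by (simp add: eval_H_monom)
qed

lemma negative_part_iff: "f \<in> negative_part \<longleftrightarrow> supported_in {..<0} f"
  by (simp add: negative_part_def supported_in_def)

lemma eval_H_negative_part:
  assumes "f \<in> negative_part"
  shows "eval_H H f - emb (poly H 0) \<in> negative_part"
proof -
  \<comment> \<open>The constant term prevents a strict bound in the induction. Strictness returns
    below, when the factor \<open>f\<close> in front of the remaining polynomial is used.\<close>
  have nonpos: "supported_in {..0} (eval_H H f)" for H
  proof (induction H)
    case (pCons c H)
    have "supported_in {..0} (f * eval_H H f)"
      using assms pCons.IH by (intro supported_in_mult[of "{..<0}" f "{..0}"])
        (auto simp: negative_part_iff)
    moreover have "supported_in {..0} (emb c)"
      using supported_in_emb by (rule supported_in_mono) auto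
    ultimately show ?case by (simp add: eval_H_pCons supported_in_add)
  qed simp
  obtain c G where H: "H = pCons c G" by (cases H)
  have "supported_in {..<0} (f * eval_H G f)"
    using assms nonpos[of G] by (intro supported_in_mult[of "{..<0}" f "{..0}"])
      (auto simp: negative_part_iff)
  then show ?thesis by (simp add: H eval_H_pCons negative_part_iff)
qed

section \<open>The polynomial determined by its polar part\<close>

lemma var_x_power: "var_x ^ k = fps_const (Poly_Mapping.single (int k) 1)"
  by (induction k) (auto simp: var_x_def mult_single fps_const_mult algebra_simps)

lemma supported_in_var_x_power: "supported_in {int k} (var_x ^ k)"
  by (simp add: var_x_power supported_in_fps_const)

lemma supported_in_emb_mult: "supported_in A f \<Longrightarrow> supported_in A (emb c * f)"
  by (rule supported_in_mult[OF supported_in_emb]) auto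

text \<open>In this section \<open>W\<close> plays the role of \<open>W\<^sub>B\<close>: \<open>x\<close> plus nonpositive powers of \<open>x\<close>.\<close>

lemma power_leading_term:
  assumes "supported_in {..0} (W - var_x)"
  shows "supported_in {..<int k} (W ^ k - var_x ^ k)"
proof (induction k)
  case (Suc k)
  have "supported_in {..1} (var_x ^ 1)"
    using supported_in_var_x_power[of 1] by (rule supported_in_mono) auto
  then have W: "supported_in {..1} W"
    using supported_in_add[of "{..1}" "W - var_x" "var_x"] supported_in_mono[OF assms, of "{..1}"]
    by auto
  have "W ^ Suc k - var_x ^ Suc k = W * (W ^ k - var_x ^ k) + (W - var_x) * var_x ^ k"
    by (simp add: algebra_simps)
  moreover have "supported_in {..<int (Suc k)} (W * (W ^ k - var_x ^ k))"
    by (rule supported_in_mult[OF W Suc.IH]) auto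
  moreover have "supported_in {..<int (Suc k)} ((W - var_x) * var_x ^ k)"
    by (rule supported_in_mult[OF assms supported_in_var_x_power]) auto
  ultimately show ?case by (simp add: supported_in_add)
qed simp

lemma supported_in_power:
  assumes "supported_in {..0} (W - var_x)"
  shows "supported_in {..int k} (W ^ k)"
proof -
  have "supported_in {..int k} (W ^ k - var_x ^ k)" "supported_in {..int k} (var_x ^ k)"
    by (rule supported_in_mono[OF power_leading_term[OF assms]], force)
      (rule supported_in_mono[OF supported_in_var_x_power], simp)
  from supported_in_add[OF this] show ?thesis by simp
qed

text \<open>If \<open>G\<close> had degree \<open>d\<close>, the term of \<open>G(W)\<close> at
  \<open>x^d\<close> would be its leading coefficient, but \<open>d\<close> is not a negative
  exponent.\<close>

lemma polar_part_inj:
  assumes W: "supported_in {..0} (W - var_x)" and neg: "eval_H G W \<in> negative_part"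
  shows "G = 0"
proof (rule ccontr)
  assume "G \<noteq> 0"
  define d where "d = degree G"
  have "supported_in {..<int d} (\<Sum>i<d. emb (coeff G i) * W ^ i)"
    by (intro supported_in_sum supported_in_emb_mult)
      (rule supported_in_mono[OF supported_in_power[OF W]], auto)
  moreover have "supported_in {..<int d} (emb (coeff G d) * (W ^ d - var_x ^ d))"
    by (intro supported_in_emb_mult power_leading_term W)
  moreover have "supported_in {..<int d} (eval_H G W)"
    using neg by (auto simp: negative_part_iff intro: supported_in_mono)
  \<comment> \<open>Solving for the leading monomial: every term on the right has only exponents
    below \<open>d\<close>.\<close>
  moreover have "emb (coeff G d) * var_x ^ d = eval_H G W - (\<Sum>i<d. emb (coeff G i) * W ^ i)
      - emb (coeff G d) * (W ^ d - var_x ^ d)"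
    by (simp add: eval_H_altdef d_def[symmetric] lessThan_Suc_atMost[symmetric] algebra_simps)
  ultimately have "supported_in {..<int d} (emb (coeff G d) * var_x ^ d)"
    by (simp add: supported_in_diff)
  then have "\<forall>n. fps_nth (coeff G d) n = 0"
    by (auto simp: supported_in_def var_x_power emb_def mult_single split: if_splits)
  then have "coeff G d = 0" by (simp add: fps_eq_iff)
  then show False using \<open>G \<noteq> 0\<close> by (simp add: d_def)
qed

text \<open>Successive elimination from the top: the coefficient of the highest nonnegative power of
  \<open>x\<close> is removed by a multiple of the same power of \<open>W\<close>, which disturbs
  only lower exponents.\<close>

lemma polar_part_surj:
  assumes W: "supported_in {..0} (W - var_x)"
  shows "supported_in {..<int m} f \<Longrightarrow>
    \<exists>H. (\<forall>i\<ge>m. coeff H i = 0) \<and> f - eval_H H W \<in> negative_part"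
proof (induction m arbitrary: f)
  case 0
  then show ?case by (intro exI[of _ 0]) (simp add: negative_part_iff)
next
  case (Suc m)
  \<comment> \<open>The coefficient of \<open>x^m\<close> in \<open>f\<close>, itself a power series
    in \<open>t\<close>.\<close>
  define c where "c = Abs_fps (\<lambda>n. Poly_Mapping.lookup (fps_nth f n) (int m))"
  have "supported_in {..<int m} (f - emb c * var_x ^ m)"
    using Suc.prems
    by (auto simp: supported_in_iff_lookup var_x_power emb_def c_def mult_single lookup_minus
        lookup_single when_def)
  moreover have "supported_in {..<int m} (emb c * (W ^ m - var_x ^ m))"
    by (intro supported_in_emb_mult power_leading_term W)
  ultimately have "supported_in {..<int m} (f - emb c * W ^ m)"
    using supported_in_diff[of "{..<int m}" "f - emb c * var_x ^ m" "emb c * (W ^ m - var_x ^ m)"]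
    by (simp add: algebra_simps)
  then obtain H where H: "\<forall>i\<ge>m. coeff H i = 0" "f - emb c * W ^ m - eval_H H W \<in> negative_part"
    using Suc.IH by blast
  then show ?case
    by (intro exI[of _ "H + monom c m"]) (auto simp: eval_H_add eval_H_monom algebra_simps)
qed

lemma polar_part_var_x_power:
  assumes "supported_in {..0} (W - var_x)"
  obtains H where "degree H = p" "var_x ^ p - eval_H H W \<in> negative_part"
proof -
  have "supported_in {..<int p} (var_x ^ p - W ^ p)"
    using supported_in_uminus[OF power_leading_term[OF assms, of p]] by simp
  then obtain H where H: "\<forall>i\<ge>p. coeff H i = 0" "var_x ^ p - W ^ p - eval_H H W \<in> negative_part"
    using polar_part_surj[OF assms] by blast
  \<comment> \<open>\<open>W ^ p\<close> already accounts for the leading term, so the correction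
    \<open>H\<close> stops below \<open>p\<close> and the sum is monic.\<close>
  have "degree (monom 1 p + H) = p"
    using H(1) by (intro antisym degree_le le_degree) auto
  moreover have "var_x ^ p - eval_H (monom 1 p + H) W \<in> negative_part"
    using H(2) by (simp add: eval_H_add eval_H_monom emb_simps algebra_simps)
  ultimately show ?thesis by (rule that)
qed

section \<open>Invariant pairs\<close>

definition kernel :: "point set \<Rightarrow> (point \<Rightarrow> real) \<Rightarrow> (point \<Rightarrow>\<^sub>0 real) fps"
  where "kernel S w = 1 - fps_X * fps_const (\<Sum>s\<in>S. Poly_Mapping.single s (w s))"

definition invariant_pair ::
    "point set \<Rightarrow> (point \<Rightarrow> real) \<Rightarrow> laurent_series_t \<Rightarrow> laurent_series_t \<Rightarrow> bool"
  where "invariant_pair S w \<alpha> \<beta> \<longleftrightarrow>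
    (\<exists>D. supported_in cone D \<and> kernel S w * D = in_x \<alpha> - in_y \<beta>)"

lemma supported_in_fps_X: "supported_in {0} (fps_X :: ('a::monoid_add \<Rightarrow>\<^sub>0 'b::semiring_1) fps)"
  by (simp add: supported_in_def fps_X_def)

text \<open>With small steps, multiplication by the kernel moves a support by at most one row and
  one column; the product argument relies on this margin.\<close>

lemma supported_in_kernel:
  assumes "S \<subseteq> small_steps"
  shows "supported_in ({-1..1} \<times> {-1..1}) (kernel S w)"
proof -
  let ?A = "{-1..1} \<times> {-1..1} :: point set"
  have "Poly_Mapping.keys (\<Sum>s\<in>S. Poly_Mapping.single s (w s)) \<subseteq> ?A"
    using assms by (intro keys_sum_subset) (auto simp: small_steps_def)
  then have "supported_in ?A (fps_X * fps_const (\<Sum>s\<in>S. Poly_Mapping.single s (w s)))"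
    by (intro supported_in_mult[OF supported_in_fps_X, of ?A]) (simp_all add: supported_in_fps_const)
  moreover have "supported_in ?A (1 :: (point \<Rightarrow>\<^sub>0 real) fps)"
    by (rule supported_in_mono[OF supported_in_one]) (auto simp: zero_prod_def)
  ultimately show ?thesis unfolding kernel_def by (intro supported_in_diff)
qed

text \<open>Since the kernel is 1 up to a multiple of \<open>t\<close>, the first nonzero
  coefficient of \<open>E\<close> would survive in the product and lie both inside and outside the
  cone.\<close>

lemma kernel_mult_eq_0:
  assumes E: "supported_in cone E" and KE: "supported_in (- cone) (kernel S w * E)"
  shows "E = 0"
proof -
  let ?\<sigma> = "\<Sum>s\<in>S. Poly_Mapping.single s (w s)"
  have disj: "p = 0" if "Poly_Mapping.keys p \<subseteq> cone" "Poly_Mapping.keys p \<subseteq> - cone"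
    for p :: "point \<Rightarrow>\<^sub>0 real"
    using that by (metis Compl_disjoint Int_subset_iff keys_eq_empty subset_empty)
  have eq: "kernel S w * E = E - fps_X * (fps_const ?\<sigma> * E)"
    by (simp add: kernel_def algebra_simps)
  have "fps_nth E n = 0" for n
  proof (induction n)
    case 0
    have "fps_nth (kernel S w * E) 0 = fps_nth E 0" by (simp add: eq)
    then show ?case using disj E KE by (metis supported_in_def)
  next
    case (Suc n)
    have "fps_nth (kernel S w * E) (Suc n) = fps_nth E (Suc n)"
      using Suc.IH by (simp add: eq)
    then show ?case using disj E KE by (metis supported_in_def)
  qed
  then show ?thesis by (simp add: fps_eq_iff)
qed

lemma lookup_eqI_supported:
  fixes f g :: "('a \<Rightarrow>\<^sub>0 'b::ab_group_add) fps"
  assumes "supported_in A (f - g)" "T \<notin> A"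
  shows "Poly_Mapping.lookup (fps_nth f n) T = Poly_Mapping.lookup (fps_nth g n) T"
  using assms by (auto simp: supported_in_iff_lookup lookup_minus)

text \<open>The quotient for the product pair is \<open>D\<^sub>1 \<alpha>\<^sub>2 + \<beta>\<^sub>1 D\<^sub>2\<close>. To see that its coefficient at a point
  \<open>T = (a, b)\<close> outside the cone vanishes, cut \<open>D\<^sub>1\<close> down to \<open>N\<close>, its part in \<open>{i \<ge> 1, j \<le> b}\<close>:
  at \<open>T\<close>, the products \<open>D\<^sub>1 \<alpha>\<^sub>2\<close> and \<open>N (K D\<^sub>2)\<close> agree, and so do \<open>- \<beta>\<^sub>1 D\<^sub>2\<close> and \<open>(K N) D\<^sub>2\<close>.\<close>

lemma invariant_quotient_product:
  assumes S: "S \<subseteq> small_steps"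
    and D1: "supported_in cone D1" "kernel S w * D1 = in_x \<alpha>1 - in_y \<beta>1"
    and D2: "supported_in cone D2" "kernel S w * D2 = in_x \<alpha>2 - in_y \<beta>2"
  shows "supported_in cone (D1 * in_x \<alpha>2 + in_y \<beta>1 * D2)"
  unfolding supported_in_iff_lookup
proof (intro allI impI)
  fix n T assume "T \<notin> cone"
  then obtain a b where T: "T = (a, b)" "a \<le> 0" "b \<le> 0"
    by (cases T) (auto simp: cone_def not_less)
  let ?K = "kernel S w"
  define N where "N = restrict_supp ({1..} \<times> {..b}) D1"
  have N: "supported_in ({1..} \<times> {..b}) N"
    unfolding N_def by (rule supported_in_mono[OF supported_in_restrict[OF D1(1)]]) auto
  \<comment> \<open>What is left of \<open>D1\<close> either has a row index above \<open>b\<close>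
    or a column index at most 0; in the latter case the cone forces a positive row index, which
    exceeds \<open>b\<close> because \<open>b \<le> 0\<close>.\<close>
  have N': "supported_in (UNIV \<times> {b+1..}) (D1 - N)"
    unfolding N_def using T(3)
    by (intro supported_in_mono[OF supported_in_diff_restrict[OF D1(1)]]) (auto simp: cone_def)
  note K = supported_in_kernel[OF S, of w]

  have "supported_in (UNIV \<times> {b..}) (?K * (D1 - N))"
    by (rule supported_in_mult[OF K N']) auto
  moreover have "supported_in (UNIV \<times> {b..}) (in_x \<alpha>1)"
    using T(3) by (intro supported_in_mono[OF supported_in_x_axis]) auto
  \<comment> \<open>The same series written in two ways: the right side bounds its rows from below,
    the left side its columns.\<close>
  moreover have "in_y \<beta>1 + ?K * N = in_x \<alpha>1 - ?K * (D1 - N)"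
    using D1(2) by (simp add: algebra_simps)
  ultimately have upper: "supported_in (UNIV \<times> {b..}) (in_y \<beta>1 + ?K * N)"
    by (simp add: supported_in_diff)
  have "supported_in ({0..} \<times> UNIV) (?K * N)"
    by (rule supported_in_mult[OF K N]) auto
  moreover have "supported_in ({0..} \<times> UNIV) (in_y \<beta>1)"
    by (rule supported_in_mono[OF supported_in_y_axis]) auto
  ultimately have "supported_in ({0..} \<times> UNIV) (in_y \<beta>1 + ?K * N)"
    by (simp add: supported_in_add)
  with upper have "supported_in ({0..} \<times> {b..}) (in_y \<beta>1 + ?K * N)"
    unfolding supported_in_def by blast
  \<comment> \<open>Subtracting from \<open>T\<close> a point of the quadrant
    \<open>{0..} \<times> {b..}\<close> leaves both coordinates nonpositive, hence never a cone
    point.\<close>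
  then have "supported_in (- {T}) ((in_y \<beta>1 + ?K * N) * D2)"
    using T(2,3) by (elim supported_in_mult[OF _ D2(1)]) (auto simp: T(1) cone_def)
  then have 1: "Poly_Mapping.lookup (fps_nth (in_y \<beta>1 * D2) n) T
      = Poly_Mapping.lookup (fps_nth (- (?K * N * D2)) n) T"
    by (intro lookup_eqI_supported[of "- {T}"]) (simp_all add: algebra_simps)

  have "supported_in (- {T}) ((D1 - N) * in_x \<alpha>2)"
    by (rule supported_in_mult[OF N' supported_in_x_axis]) (auto simp: T(1))
  moreover have "supported_in (- {T}) (N * in_y \<beta>2)"
    using T(2) by (intro supported_in_mult[OF N supported_in_y_axis]) (auto simp: T(1))
  \<comment> \<open>Neither term on the right reaches \<open>T\<close>: the first stays in rows
    above \<open>b\<close>, the second in columns with positive index, while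
    \<open>a \<le> 0\<close>.\<close>
  moreover have "D1 * in_x \<alpha>2 - N * (?K * D2) = (D1 - N) * in_x \<alpha>2 + N * in_y \<beta>2"
    by (simp only: D2(2)) (simp add: algebra_simps)
  ultimately have "supported_in (- {T}) (D1 * in_x \<alpha>2 - N * (?K * D2))"
    by (simp add: supported_in_add)
  then have 2: "Poly_Mapping.lookup (fps_nth (D1 * in_x \<alpha>2) n) T
      = Poly_Mapping.lookup (fps_nth (N * (?K * D2)) n) T"
    by (rule lookup_eqI_supported) simp
  have "N * (?K * D2) = ?K * N * D2" by (simp add: algebra_simps)
  with 1 2 show "Poly_Mapping.lookup (fps_nth (D1 * in_x \<alpha>2 + in_y \<beta>1 * D2) n) T = 0"
    by (simp add: lookup_add)
qed

text \<open>The algebra is the telescoping \<open>(\<alpha>1 - \<beta>1) \<alpha>2 + \<beta>1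
  (\<alpha>2 - \<beta>2)\<close>; that the resulting quotient stays in the cone is the preceding
  lemma.\<close>

lemma invariant_pair_mult:
  assumes S: "S \<subseteq> small_steps"
    and "invariant_pair S w \<alpha>1 \<beta>1" "invariant_pair S w \<alpha>2 \<beta>2"
  shows "invariant_pair S w (\<alpha>1 * \<alpha>2) (\<beta>1 * \<beta>2)"
proof -
  obtain D1 where D1: "supported_in cone D1" "kernel S w * D1 = in_x \<alpha>1 - in_y \<beta>1"
    using assms(2) by (auto simp: invariant_pair_def)
  obtain D2 where D2: "supported_in cone D2" "kernel S w * D2 = in_x \<alpha>2 - in_y \<beta>2"
    using assms(3) by (auto simp: invariant_pair_def)
  have "kernel S w * (D1 * in_x \<alpha>2 + in_y \<beta>1 * D2)
      = (kernel S w * D1) * in_x \<alpha>2 + in_y \<beta>1 * (kernel S w * D2)"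
    by (simp add: algebra_simps)
  also have "\<dots> = in_x (\<alpha>1 * \<alpha>2) - in_y (\<beta>1 * \<beta>2)"
    by (simp only: D1(2) D2(2) in_x_simps in_y_simps) (simp add: algebra_simps)
  finally show ?thesis
    using invariant_quotient_product[OF S D1 D2] by (auto simp: invariant_pair_def)
qed

lemma invariant_pair_add:
  assumes "invariant_pair S w \<alpha>1 \<beta>1" "invariant_pair S w \<alpha>2 \<beta>2"
  shows "invariant_pair S w (\<alpha>1 + \<alpha>2) (\<beta>1 + \<beta>2)"
proof -
  obtain D1 where D1: "supported_in cone D1" "kernel S w * D1 = in_x \<alpha>1 - in_y \<beta>1"
    using assms(1) by (auto simp: invariant_pair_def)
  obtain D2 where D2: "supported_in cone D2" "kernel S w * D2 = in_x \<alpha>2 - in_y \<beta>2"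
    using assms(2) by (auto simp: invariant_pair_def)
  have "kernel S w * (D1 + D2) = in_x (\<alpha>1 + \<alpha>2) - in_y (\<beta>1 + \<beta>2)"
    by (simp add: distrib_left D1(2) D2(2) in_x_simps in_y_simps)
  then show ?thesis
    unfolding invariant_pair_def using supported_in_add[OF D1(1) D2(1)] by blast
qed

text \<open>A series in \<open>t\<close> alone sits at the origin on both axes, so the quotient is
  0.\<close>

lemma invariant_pair_emb: "invariant_pair S w (emb c) (emb c)"
  unfolding invariant_pair_def by (intro exI[of _ 0]) (simp add: in_x_emb)

lemma invariant_pair_eval_H:
  assumes "S \<subseteq> small_steps" "invariant_pair S w \<alpha> \<beta>"
  shows "invariant_pair S w (eval_H H \<alpha>) (eval_H H \<beta>)"
proof (induction H)
  case 0
  show ?case using invariant_pair_emb[of S w 0] by (simp add: emb_simps)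
next
  case (pCons c H)
  then show ?case
    using assms by (auto simp: eval_H_pCons intro!: invariant_pair_add invariant_pair_mult invariant_pair_emb)
qed

text \<open>The difference of the right-hand sides avoids the cone, so the quotients agree. What
  remains equates series on two disjoint half-axes; only the \<open>y\<close> side may contain the
  origin, which is why the two sign conditions differ.\<close>

lemma invariant_pair_unique:
  assumes "invariant_pair S w \<alpha>1 \<beta>1" "invariant_pair S w \<alpha>2 \<beta>2"
    and "\<alpha>1 - \<alpha>2 \<in> negative_part" "supported_in {..0} (\<beta>1 - \<beta>2)"
  shows "\<alpha>1 = \<alpha>2 \<and> \<beta>1 = \<beta>2"
proof -
  obtain D1 where D1: "supported_in cone D1" "kernel S w * D1 = in_x \<alpha>1 - in_y \<beta>1"
    using assms(1) by (auto simp: invariant_pair_def)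
  obtain D2 where D2: "supported_in cone D2" "kernel S w * D2 = in_x \<alpha>2 - in_y \<beta>2"
    using assms(2) by (auto simp: invariant_pair_def)
  have eq: "kernel S w * (D1 - D2) = in_x (\<alpha>1 - \<alpha>2) - in_y (\<beta>1 - \<beta>2)"
    using D1(2) D2(2) by (simp add: in_x_simps in_y_simps algebra_simps)
  have sx: "supported_in ({..<0} \<times> {0}) (in_x (\<alpha>1 - \<alpha>2))"
    using assms(3) by (auto simp: negative_part_iff intro: supported_in_in_x)
  have sy: "supported_in ({0} \<times> {..0}) (in_y (\<beta>1 - \<beta>2))"
    using assms(4) by (rule supported_in_in_y)
  have "supported_in (- cone) (in_x (\<alpha>1 - \<alpha>2) - in_y (\<beta>1 - \<beta>2))"
    by (intro supported_in_diff supported_in_mono[OF sx] supported_in_mono[OF sy])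
      (auto simp: cone_def)
  then have "D1 - D2 = 0"
    using D1(1) D2(1) by (intro kernel_mult_eq_0[of _ S w]) (auto simp: eq intro: supported_in_diff)
  with eq have xy: "in_x (\<alpha>1 - \<alpha>2) = in_y (\<beta>1 - \<beta>2)" by simp
  then have "in_x (\<alpha>1 - \<alpha>2) = 0"
    using sx sy by (intro supported_in_disjoint[of "{..<0} \<times> {0}" _ "{0} \<times> {..0}"]) auto
  with xy have "\<alpha>1 - \<alpha>2 = 0" "\<beta>1 - \<beta>2 = 0"
    by (simp_all only: in_x_eq_0 in_y_eq_0)
  then show ?thesis by simp
qed

section \<open>Walks in the cone\<close>

text \<open>These walks supply the cone quotient \<open>D\<close>. Length 0 is allowed: the empty
  walk yields the monomial of the starting point.\<close>

definition stay_walks :: "point set \<Rightarrow> point \<Rightarrow> nat \<Rightarrow> point list set"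
  where "stay_walks S u n = {s. length s = n \<and> set s \<subseteq> S \<and> (\<forall>k\<le>n. u + sum_list (take k s) \<in> cone)}"

definition endpoint_poly :: "(point \<Rightarrow> real) \<Rightarrow> point \<Rightarrow> point list set \<Rightarrow> (point \<Rightarrow>\<^sub>0 real)"
  where "endpoint_poly w u X = (\<Sum>s\<in>X. Poly_Mapping.single (u + sum_list s) (walk_weight w s))"

lemma finite_exit_walks: "finite S \<Longrightarrow> finite (exit_walks S u n)"
  by (rule finite_subset[OF _ finite_lists_length_eq[of S n]]) (auto simp: exit_walks_def)

lemma finite_stay_walks: "finite S \<Longrightarrow> finite (stay_walks S u n)"
  by (rule finite_subset[OF _ finite_lists_length_eq[of S n]]) (auto simp: stay_walks_def)

lemma stay_walks_0: "u \<in> cone \<Longrightarrow> stay_walks S u 0 = {[]}"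
  by (auto simp: stay_walks_def)

lemma exit_walks_0: "exit_walks S u 0 = {}"
  by (auto simp: exit_walks_def)

text \<open>After one more step, a walk in the cone either remains there or leaves it for the first
  time; both cases constrain the earlier points alike.\<close>

lemma bij_betw_append_step:
  "bij_betw (\<lambda>(s, d). s @ [d]) (stay_walks S u n \<times> S) (stay_walks S u (Suc n) \<union> exit_walks S u (Suc n))"
proof (rule bij_betw_imageI)
  show "inj_on (\<lambda>(s, d). s @ [d]) (stay_walks S u n \<times> S)"
    by (auto simp: inj_on_def)
  have mem: "s' \<in> stay_walks S u (Suc n) \<union> exit_walks S u (Suc n) \<longleftrightarrow>
      length s' = Suc n \<and> set s' \<subseteq> S \<and> (\<forall>k\<le>n. u + sum_list (take k s') \<in> cone)" for s'
  proof -
    have "(\<forall>k\<le>Suc n. u + sum_list (take k s') \<in> cone) \<longleftrightarrow>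
        (\<forall>k\<le>n. u + sum_list (take k s') \<in> cone) \<and> u + sum_list s' \<in> cone"
      if "length s' = Suc n"
      using that by (metis le_Suc_eq order_refl take_all)
    then show ?thesis
      unfolding stay_walks_def exit_walks_def Un_iff mem_Collect_eq less_Suc_eq_le
      by (cases "u + sum_list s' \<in> cone") auto
  qed
  have append: "s @ [d] \<in> stay_walks S u (Suc n) \<union> exit_walks S u (Suc n) \<longleftrightarrow>
      s \<in> stay_walks S u n \<and> d \<in> S" for s d
    unfolding mem unfolding stay_walks_def by auto
  show "(\<lambda>(s, d). s @ [d]) ` (stay_walks S u n \<times> S)
      = stay_walks S u (Suc n) \<union> exit_walks S u (Suc n)" (is "?L = ?R")
  proof (intro equalityI subsetI)
    fix s' assume "s' \<in> ?L"
    then show "s' \<in> ?R" using append by fast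
  next
    fix s' assume s': "s' \<in> ?R"
    then have "s' \<noteq> []" using mem by auto
    then obtain s d where "s' = s @ [d]" by (cases s' rule: rev_cases) auto
    then show "s' \<in> ?L" using s' append by fast
  qed
qed

lemma endpoint_poly_step:
  assumes "finite S"
  shows "(\<Sum>d\<in>S. Poly_Mapping.single d (w d)) * endpoint_poly w u (stay_walks S u n)
    = endpoint_poly w u (stay_walks S u (Suc n)) + endpoint_poly w u (exit_walks S u (Suc n))"
proof -
  have "(\<Sum>d\<in>S. Poly_Mapping.single d (w d)) * endpoint_poly w u (stay_walks S u n)
      = (\<Sum>(s, d)\<in>stay_walks S u n \<times> S.
          Poly_Mapping.single (u + sum_list (s @ [d])) (walk_weight w (s @ [d])))"
    unfolding endpoint_poly_def sum_product
    by (subst sum.swap, unfold sum.cartesian_product, rule sum.cong)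
      (auto simp: mult_single walk_weight_def add_ac mult.commute)
  also have "\<dots> = endpoint_poly w u (stay_walks S u (Suc n) \<union> exit_walks S u (Suc n))"
    unfolding endpoint_poly_def
    unfolding sum.reindex_bij_betw[OF bij_betw_append_step, symmetric] case_prod_unfold ..
  also have "\<dots> = endpoint_poly w u (stay_walks S u (Suc n)) + endpoint_poly w u (exit_walks S u (Suc n))"
    unfolding endpoint_poly_def using assms
    by (intro sum.union_disjoint finite_stay_walks finite_exit_walks)
      (auto simp: stay_walks_def exit_walks_def)
  finally show ?thesis .
qed

text \<open>The last point inside has a positive coordinate, which a small step lowers by at most
  one. Outside the cone that coordinate must be 0, and the other is nonpositive.\<close>

lemma exit_point_on_axes:
  assumes "S \<subseteq> small_steps" "s \<in> exit_walks S u n"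
  shows "(\<exists>j<0. u + sum_list s = (0, j)) \<or> (\<exists>i<0. u + sum_list s = (i, 0)) \<or> u + sum_list s = (0, 0)"
proof -
  obtain m where n: "n = Suc m" using assms(2) by (cases n) (auto simp: exit_walks_def)
  then have "s \<in> (\<lambda>(s, d). s @ [d]) ` (stay_walks S u m \<times> S)"
    using assms(2) bij_betw_append_step[of S u m] unfolding bij_betw_def by blast
  then obtain s' d where s: "s = s' @ [d]" "d \<in> S" "s' \<in> stay_walks S u m" by auto
  then have s': "u + sum_list s' \<in> cone" by (auto simp: stay_walks_def)
  have "u + sum_list s = (u + sum_list s') + d" by (simp add: s add.assoc)
  moreover have "u + sum_list s \<notin> cone" using assms(2) by (simp add: exit_walks_def)
  moreover have "d \<in> {-1..1} \<times> {-1..1}" using s(2) assms(1) by (auto simp: small_steps_def)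
  ultimately show ?thesis
    using s' by (cases "u + sum_list s'"; cases d; auto simp: cone_def)
qed

section \<open>The functional equation for exits from the cone\<close>

definition exit_gf :: "point set \<Rightarrow> (point \<Rightarrow> real) \<Rightarrow> point \<Rightarrow> (point \<Rightarrow>\<^sub>0 real) fps"
  where "exit_gf S w u = Abs_fps (\<lambda>n. endpoint_poly w u (exit_walks S u n))"

lemma kernel_mult_stay:
  assumes "finite S" "u \<in> cone"
  shows "kernel S w * Abs_fps (\<lambda>n. endpoint_poly w u (stay_walks S u n))
    = fps_const (Poly_Mapping.single u 1) - exit_gf S w u" (is "?K * ?C = _")
proof (rule fps_ext)
  fix n
  let ?\<sigma> = "\<Sum>s\<in>S. Poly_Mapping.single s (w s)"
  have "?K * ?C = ?C - fps_X * (fps_const ?\<sigma> * ?C)"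
    by (simp add: kernel_def algebra_simps)
  then show "fps_nth (?K * ?C) n = fps_nth (fps_const (Poly_Mapping.single u 1) - exit_gf S w u) n"
    using assms
    \<comment> \<open>At order 0 only the empty walk contributes; at order \<open>n + 1\<close> the
      step identity leaves exactly the exits, with a minus sign.\<close>
    by (cases n) (auto simp: exit_gf_def endpoint_poly_step stay_walks_0 exit_walks_0
        endpoint_poly_def[of w u "{[]}"] endpoint_poly_def[of w u "{}"] walk_weight_def
        simp del: sum_list.append)
qed

lemma exit_gf_eq:
  assumes "S \<subseteq> small_steps"
  shows "exit_gf S w (int p, 0)
    = in_y (gf_A S w p) + in_x (gf_B S w p) + in_x (emb (gf_F S w p))"
proof (rule fps_ext)
  fix n
  let ?e = "\<lambda>s. (int p, 0) + sum_list s"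
  let ?X = "exit_walks S (int p, 0) n"
  let ?A = "{s \<in> ?X. \<exists>j<0. ?e s = (0, j)}"
  let ?B = "{s \<in> ?X. \<exists>i<0. ?e s = (i, 0)}"
  let ?F = "{s \<in> ?X. ?e s = (0, 0)}"
  have "finite S" using assms by (rule finite_subset) (simp add: small_steps_def)
  then have fin: "finite ?X" by (rule finite_exit_walks)
  have split: "?X = ?A \<union> ?B \<union> ?F"
    using exit_point_on_axes[OF assms, of _ "(int p, 0)" n] by blast
  have "fps_nth (exit_gf S w (int p, 0)) n = endpoint_poly w (int p, 0) (?A \<union> ?B \<union> ?F)"
    unfolding exit_gf_def using split by simp
  also have "\<dots> = endpoint_poly w (int p, 0) ?A + endpoint_poly w (int p, 0) ?B
      + endpoint_poly w (int p, 0) ?F"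
    unfolding endpoint_poly_def using fin
    by (subst sum.union_disjoint, simp, simp, force, subst sum.union_disjoint) auto
  also have "endpoint_poly w (int p, 0) ?A = fps_nth (in_y (gf_A S w p)) n"
    unfolding endpoint_poly_def in_y_def gf_A_def subst_def
    by (auto simp: push_sum simp del: fst_add snd_add intro!: sum.cong)
  also have "endpoint_poly w (int p, 0) ?B = fps_nth (in_x (gf_B S w p)) n"
    unfolding endpoint_poly_def in_x_def gf_B_def subst_def
    by (auto simp: push_sum simp del: fst_add snd_add intro!: sum.cong)
  also have "endpoint_poly w (int p, 0) ?F = fps_nth (in_x (emb (gf_F S w p))) n"
    unfolding endpoint_poly_def in_x_def gf_F_def subst_def emb_def
    by (auto simp: push_sum single_sum intro!: sum.cong)
  finally show "fps_nth (exit_gf S w (int p, 0)) n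
      = fps_nth (in_y (gf_A S w p) + in_x (gf_B S w p) + in_x (emb (gf_F S w p))) n" by simp
qed

lemma invariant_pair_gf:
  assumes "S \<subseteq> small_steps" "p \<ge> 1"
  shows "invariant_pair S w (var_x ^ p - emb (gf_F S w p) - gf_B S w p) (gf_A S w p)"
proof -
  have "finite S" using assms(1) by (rule finite_subset) (simp add: small_steps_def)
  \<comment> \<open>The hypothesis \<open>p \<ge> 1\<close> puts the start inside the cone, so the
    empty walk counts.\<close>
  moreover have "(int p, 0) \<in> cone" using assms(2) by (simp add: cone_def)
  moreover have "in_x (var_x ^ p) = fps_const (Poly_Mapping.single (int p, 0) 1)"
    by (rule fps_ext) (simp add: in_x_def subst_def var_x_power)
  ultimately have "kernel S w * Abs_fps (\<lambda>n. endpoint_poly w (int p, 0) (stay_walks S (int p, 0) n))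
      = in_x (var_x ^ p - emb (gf_F S w p) - gf_B S w p) - in_y (gf_A S w p)"
    by (simp add: kernel_mult_stay exit_gf_eq[OF assms(1)] in_x_simps algebra_simps)
  moreover have "supported_in cone (Abs_fps (\<lambda>n. endpoint_poly w u (stay_walks S u n)))" for u
    unfolding supported_in_def endpoint_poly_def fps_nth_Abs_fps
    by (intro allI keys_sum_subset) (auto simp: stay_walks_def)
  ultimately show ?thesis unfolding invariant_pair_def by blast
qed

section \<open>Signs of exponents and the conclusion\<close>

lemma gf_A_negative: "gf_A S w p \<in> negative_part"
  unfolding negative_part_def gf_A_def mem_Collect_eq fps_nth_Abs_fps
  by (intro allI keys_sum_subset) (auto simp del: snd_add)

lemma gf_B_negative: "gf_B S w p \<in> negative_part"
  unfolding negative_part_def gf_B_def mem_Collect_eq fps_nth_Abs_fps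
  by (intro allI keys_sum_subset) (auto simp del: fst_add)

lemma W_B_leading_term: "supported_in {..0} (W_B S w - var_x)"
proof -
  have "supported_in {..0} (emb (gf_F S w 1))" "supported_in {..0} (gf_B S w 1)"
    using supported_in_mono[OF supported_in_emb, of "{..0}"] gf_B_negative[of S w 1]
    by (auto simp: negative_part_iff intro: supported_in_mono)
  from supported_in_uminus[OF supported_in_add[OF this]] show ?thesis
    by (simp add: W_B_def algebra_simps)
qed

theorem theorem4p18:
  fixes S :: "point set" and w :: "point \<Rightarrow> real" and p :: nat
  assumes "S \<subseteq> small_steps"
    and "non_singular S"
    and "\<forall>s\<in>S. w s > 0"
    and "p \<ge> 1"
  shows "\<exists>H :: real fps poly.
    degree H = p \<and>
    gf_A S w p = eval_H H (W_A S w) - emb (poly H 0) \<and>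
    gf_F S w p = poly H 0 \<and>
    gf_B S w p = var_x ^ p - eval_H H (W_B S w) \<and>
    (\<forall>G :: real fps poly. var_x ^ p - eval_H G (W_B S w) \<in> negative_part \<longleftrightarrow> G = H)"
proof -
  obtain H where H: "degree H = p" "var_x ^ p - eval_H H (W_B S w) \<in> negative_part"
    using polar_part_var_x_power[OF W_B_leading_term] by blast
  have "invariant_pair S w (W_B S w) (W_A S w)"
    using invariant_pair_gf[OF assms(1), of 1] by (simp add: W_A_def W_B_def)
  then have pair_H: "invariant_pair S w (eval_H H (W_B S w)) (eval_H H (W_A S w))"
    by (rule invariant_pair_eval_H[OF assms(1)])
  \<comment> \<open>Adding the constant pair moves \<open>F\<close> to the \<open>y\<close> side, so
    that the \<open>x\<close> sides of the two pairs differ by strictly negative powers, as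
    uniqueness requires.\<close>
  have pair_p: "invariant_pair S w (var_x ^ p - gf_B S w p) (gf_A S w p + emb (gf_F S w p))"
    using invariant_pair_add[OF invariant_pair_gf[OF assms(1,4)] invariant_pair_emb[of S w "gf_F S w p"]]
    by (simp add: algebra_simps)
  have A_neg: "eval_H H (W_A S w) - emb (poly H 0) \<in> negative_part"
    by (rule eval_H_negative_part) (simp add: W_A_def gf_A_negative)
  have "supported_in {..0} (gf_A S w p - (eval_H H (W_A S w) - emb (poly H 0)))"
    using supported_in_diff[of "{..<0}" "gf_A S w p" "eval_H H (W_A S w) - emb (poly H 0)"]
      gf_A_negative[of S w p] A_neg
    by (auto simp: negative_part_iff intro: supported_in_mono)
  moreover have "supported_in {..0} (emb (gf_F S w p - poly H 0))"
    by (rule supported_in_mono[OF supported_in_emb]) auto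
  ultimately have "supported_in {..0} (gf_A S w p + emb (gf_F S w p) - eval_H H (W_A S w))"
    using supported_in_add[of "{..0}" "gf_A S w p - (eval_H H (W_A S w) - emb (poly H 0))"
        "emb (gf_F S w p - poly H 0)"]
    by (simp add: emb_simps algebra_simps)
  moreover have "var_x ^ p - gf_B S w p - eval_H H (W_B S w) \<in> negative_part"
    using supported_in_diff[of "{..<0}" "var_x ^ p - eval_H H (W_B S w)" "gf_B S w p"]
      H(2) gf_B_negative[of S w p]
    by (simp add: negative_part_iff algebra_simps)
  ultimately have B: "var_x ^ p - gf_B S w p = eval_H H (W_B S w)"
    and A: "gf_A S w p + emb (gf_F S w p) = eval_H H (W_A S w)"
    using invariant_pair_unique[OF pair_p pair_H] by auto
  \<comment> \<open>The sum \<open>A + F\<close> is now known; a constant with only negative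
    exponents is 0, which separates \<open>F\<close> from \<open>A\<close>.\<close>
  have "emb (gf_F S w p - poly H 0) = (eval_H H (W_A S w) - emb (poly H 0)) - gf_A S w p"
    by (simp add: A[symmetric] emb_simps)
  then have "supported_in {..<0} (emb (gf_F S w p - poly H 0))"
    using A_neg gf_A_negative[of S w p] by (simp add: negative_part_iff supported_in_diff)
  then have "emb (gf_F S w p - poly H 0) = 0"
    by (rule supported_in_disjoint[OF _ supported_in_emb]) auto
  then have F: "gf_F S w p = poly H 0"
    using emb_eq_0[of "gf_F S w p - poly H 0"] by simp
  have unique: "G = H" if "var_x ^ p - eval_H G (W_B S w) \<in> negative_part" for G
  proof -
    have "eval_H (G - H) (W_B S w) \<in> negative_part"
      using supported_in_diff[of "{..<0}" "var_x ^ p - eval_H H (W_B S w)"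
          "var_x ^ p - eval_H G (W_B S w)"] that H(2)
      by (simp add: negative_part_iff eval_H_diff)
    then show ?thesis using polar_part_inj[OF W_B_leading_term] by fastforce
  qed
  have "gf_A S w p = eval_H H (W_A S w) - emb (poly H 0)"
    using A F by (simp add: algebra_simps)
  moreover have "gf_B S w p = var_x ^ p - eval_H H (W_B S w)"
    using B by (simp add: algebra_simps)
  ultimately show ?thesis
    using H F unique by blast
qed

end
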